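(* Let $n\ge 3$ and $r\ge 2$ be integers with $r\leq\sqrt[3]{\frac{n}{100\ln n}}$. Then $$p(n,r)\geq \frac{1}{20r^2}\left(\frac{n}{\ln n}\right)^{\frac {r-1}{r}}\left(\frac{r}{r-1}\right)^{n}.$$
   Context: A hypergraph $H=(V,E)$ is $n$-uniform if every edge has exactly $n$ vertices. A vertex $r$-coloring of $H$ is a map $V\to\{1,\dots,r\}$; it is panchromatic if every edge of $H$ contains at least one vertex of each of the $r$ colors. $p(n,r)$ denotes the minimum possible number of edges of an $n$-uniform hypergraph that does not admit a panchromatic coloring with $r$ colors. *)

theory Defs
  imports Complex_Main
begin

definition hypergraph :: "'a set \<Rightarrow> 'a set set \<Rightarrow> bool" where
  "hypergraph V E \<longleftrightarrow> finite V \<and> E \<subseteq> Pow V"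

definition uniform :: "nat \<Rightarrow> 'a set set \<Rightarrow> bool" where
  "uniform n E \<longleftrightarrow> (\<forall>e\<in>E. card e = n)"

definition vertex_coloring :: "nat \<Rightarrow> 'a set \<Rightarrow> ('a \<Rightarrow> nat) \<Rightarrow> bool" where
  "vertex_coloring r V c \<longleftrightarrow> c ` V \<subseteq> {1..r}"

definition panchromatic :: "nat \<Rightarrow> 'a set \<Rightarrow> 'a set set \<Rightarrow> ('a \<Rightarrow> nat) \<Rightarrow> bool" where
  "panchromatic r V E c \<longleftrightarrow>
     vertex_coloring r V c \<and> (\<forall>e\<in>E. \<forall>i\<in>{1..r}. \<exists>v\<in>e. c v = i)"

text \<open>Vertices are taken to be natural numbers, since HOL cannot quantify over vertex types inside
  a term; \<open>min_edges_le\<close> below shows that this loses no hypergraphs over other types, nor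
  any with infinitely many vertices.\<close>

definition min_edges :: "nat \<Rightarrow> nat \<Rightarrow> nat" where
  "min_edges n r = (LEAST m. \<exists>(V :: nat set) E.
     hypergraph V E \<and> uniform n E \<and> (\<nexists>c. panchromatic r V E c) \<and> card E = m)"

lemma min_edges_le:
  fixes V :: "'a set"
  assumes "E \<subseteq> Pow V" "finite E" "uniform n E" "n > 0" "r > 0"
    and non: "\<nexists>c. panchromatic r V E c"
  shows "min_edges n r \<le> card E"
proof -
  let ?W = "\<Union>E"
  have fin: "finite e" if "e \<in> E" for e
    using assms(3,4) that by (auto simp: uniform_def intro: card_ge_0_finite)
  then have finW: "finite ?W"
    using assms(2) by (intro finite_Union)
  then obtain f :: "'a \<Rightarrow> nat" where f: "inj_on f ?W"
    using finite_imp_inj_to_nat_seg[of "\<Union>E"] by metis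
  let ?F = "(`) f ` E"
  have "inj_on ((`) f) E"
    using f by (rule inj_on_image)
  then have cardF: "card ?F = card E"
    by (rule card_image)
  have hyp: "hypergraph (f ` ?W) ?F"
    using finW by (auto simp: hypergraph_def)
  have uni: "uniform n ?F"
    unfolding uniform_def
  proof clarify
    fix e assume "e \<in> E"
    moreover from this have "inj_on f e"
      by (intro inj_on_subset[OF f] Union_upper)
    ultimately show "card (f ` e) = n"
      using assms(3) by (simp add: card_image uniform_def)
  qed
  have "\<nexists>c. panchromatic r (f ` ?W) ?F c"
  proof
    assume "\<exists>c. panchromatic r (f ` ?W) ?F c"
    then obtain c where c: "panchromatic r (f ` ?W) ?F c" ..
    define d where "d v = (if v \<in> ?W then c (f v) else 1)" for v
    have "c (f v) \<in> {1..r}" if "v \<in> ?W" for v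
      using c imageI[OF imageI[OF that, of f], of c]
      unfolding panchromatic_def vertex_coloring_def by (elim conjE) (rule subsetD)
    then have "vertex_coloring r V d"
      using assms(5) by (simp add: vertex_coloring_def d_def image_subset_iff)
    moreover have "\<exists>v\<in>e. d v = i" if "e \<in> E" "i \<in> {1..r}" for e i
    proof -
      have "\<exists>w\<in>f ` e. c w = i"
        using c that by (simp add: panchromatic_def)
      then obtain v where "v \<in> e" "c (f v) = i"
        by auto
      moreover have "v \<in> ?W"
        using UnionI[OF that(1) \<open>v \<in> e\<close>] .
      ultimately have "d v = i"
        unfolding d_def by (simp only: if_True)
      with \<open>v \<in> e\<close> show ?thesis ..
    qed
    ultimately have "panchromatic r V E d"
      by (simp add: panchromatic_def)
    with non show False
      by blast
  qed
  with hyp uni cardF show ?thesis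
    unfolding min_edges_def by (intro Least_le exI conjI)
qed

end

theory Submission
  imports Defs "HOL-Library.FuncSet"
begin

text \<open>Every vertex receives an independent random point of \<open>[0, 1]\<close>, which is divided into long intervals
  \<open>\<Delta>\<^sub>0, \<dots>, \<Delta>\<^sub>r\<^sub>-\<^sub>1\<close> of length about \<open>1 / r\<close> separated by short intervals \<open>\<delta>\<^sub>0, \<dots>, \<delta>\<^sub>r\<^sub>-\<^sub>2\<close> of length \<open>q\<close>. Vertices
  in \<open>\<Delta>\<^sub>l\<close> get colour \<open>l\<close>; a vertex in \<open>\<delta>\<^sub>l\<close> gets colour \<open>l + 1\<close> unless some edge needs it for colour \<open>l\<close>.
  If an edge misses colour \<open>i\<close>, there are edges \<open>E\<^sub>i, E\<^sub>i\<^sub>-\<^sub>1, \<dots>, E\<^sub>j\<close> and vertices \<open>V\<^sub>l \<in> E\<^sub>l \<inter> E\<^sub>l\<^sub>+\<^sub>1\<close> lying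
  in \<open>\<delta>\<^sub>l\<close> such that \<open>E\<^sub>l\<close> avoids a set \<open>F\<^sub>l\<close> consisting of \<open>\<Delta>\<^sub>l\<close>, the part of \<open>\<delta>\<^sub>l\<close> after \<open>V\<^sub>l\<close> and the part
  of \<open>\<delta>\<^sub>l\<^sub>-\<^sub>1\<close> before \<open>V\<^sub>l\<^sub>-\<^sub>1\<close>. The sets \<open>F\<^sub>l\<close> are disjoint, so the avoidance events are negatively
  correlated, and a common vertex of \<open>E\<^sub>l\<close> and \<open>E\<^sub>l\<^sub>+\<^sub>1\<close> gains a factor about \<open>1 - 1 / r\<^sup>2\<close>; this pays for
  the choice of \<open>V\<^sub>l\<close> up to a factor of order \<open>r\<^sup>2\<close>. The total length of the \<open>F\<^sub>l\<close> does not depend on the positions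
  of the \<open>V\<^sub>l\<close>. With \<open>q = 2 ((r - 1) / r)\<^sup>2 ln (n / ln n) / n\<close>, few edges make the expected number of
  chains less than 1. The positions inside a short interval are discretised, which turns all
  probabilities into finite sums.\<close>

section \<open>Union bound over placements, and the gain from disjoint avoidance events\<close>

text \<open>This is the union bound: \<open>w\<close> is the law of a single vertex, and the
  probability that all vertices stay in box \<open>i\<close> factors over the vertices.\<close>

lemma box_cover_bound:
  fixes w :: "'b \<Rightarrow> real" and B :: "'i \<Rightarrow> 'a \<Rightarrow> 'b set"
  assumes "finite W" "finite \<Omega>" "finite I"
    and w_nonneg: "\<And>\<omega>. \<omega> \<in> \<Omega> \<Longrightarrow> w \<omega> \<ge> 0" and w_sum: "sum w \<Omega> = 1"
    and B_sub: "\<And>i u. i \<in> I \<Longrightarrow> u \<in> W \<Longrightarrow> B i u \<subseteq> \<Omega>"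
    and cover: "\<And>X. X \<in> W \<rightarrow>\<^sub>E \<Omega> \<Longrightarrow> \<exists>i\<in>I. \<forall>u\<in>W. X u \<in> B i u"
  shows "1 \<le> (\<Sum>i\<in>I. \<Prod>u\<in>W. sum w (B i u))"
proof -
  let ?p = "\<lambda>X. \<Prod>u\<in>W. w (X u)"
  have p_nonneg: "?p X \<ge> 0" if "X \<in> W \<rightarrow>\<^sub>E \<Omega>" for X
    using that w_nonneg by (intro prod_nonneg) (auto simp: PiE_def Pi_def)
  have sub: "PiE W (B i) \<subseteq> W \<rightarrow>\<^sub>E \<Omega>" if "i \<in> I" for i
    using B_sub[OF that] by (intro PiE_mono) auto
  have fin: "finite (W \<rightarrow>\<^sub>E \<Omega>)"
    using assms(1,2) by (intro finite_PiE)
  have "1 = (\<Prod>u\<in>W. sum w \<Omega>)"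
    by (simp add: w_sum)
  also have "\<dots> = (\<Sum>X\<in>W \<rightarrow>\<^sub>E \<Omega>. ?p X)"
    using assms(1,2) by (intro prod_sum_PiE)
  also have "\<dots> \<le> (\<Sum>X\<in>W \<rightarrow>\<^sub>E \<Omega>. \<Sum>i\<in>I. if X \<in> PiE W (B i) then ?p X else 0)"
  proof (rule sum_mono)
    fix X assume X: "X \<in> W \<rightarrow>\<^sub>E \<Omega>"
    from cover[OF X] obtain i where i: "i \<in> I" "\<forall>u\<in>W. X u \<in> B i u"
      by blast
    then have "X \<in> PiE W (B i)"
      using X by (auto simp: PiE_def)
    then have "?p X = (if X \<in> PiE W (B i) then ?p X else 0)"
      by simp
    also have "\<dots> \<le> (\<Sum>i\<in>I. if X \<in> PiE W (B i) then ?p X else 0)"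
      using p_nonneg[OF X] by (intro member_le_sum i(1) assms(3)) auto
    finally show "?p X \<le> \<dots>" .
  qed
  also have "\<dots> = (\<Sum>i\<in>I. \<Sum>X\<in>W \<rightarrow>\<^sub>E \<Omega>. if X \<in> PiE W (B i) then ?p X else 0)"
    by (rule sum.swap)
  also have "\<dots> = (\<Sum>i\<in>I. \<Sum>X\<in>PiE W (B i). ?p X)"
  proof (rule sum.cong)
    fix i assume "i \<in> I"
    then show "(\<Sum>X\<in>W \<rightarrow>\<^sub>E \<Omega>. if X \<in> PiE W (B i) then ?p X else 0) = (\<Sum>X\<in>PiE W (B i). ?p X)"
      using sub fin by (simp add: sum.If_cases Int_absorb1 flip: sum.inter_restrict)
  qed simp
  also have "\<dots> = (\<Sum>i\<in>I. \<Prod>u\<in>W. sum w (B i u))"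
    using assms(1,2) B_sub by (intro sum.cong prod_sum_PiE[symmetric]) (auto intro: finite_subset)
  finally show ?thesis .
qed

text \<open>Induction on the largest index \<open>b\<close>. Subtracting \<open>f b\<close> from
  \<open>1 - sum f S\<close> removes at least the share \<open>f b\<close> of it. If the predecessor
  of \<open>b\<close> lies in \<open>S\<close>, the remainder is at most \<open>1 - \<phi>\<close>,
  so the share is at least \<open>f b / (1 - \<phi>)\<close>, which pays for the extra
  factor.\<close>

lemma one_minus_sum_le_prod_adjacent:
  fixes f :: "nat \<Rightarrow> real"
  assumes "finite S" "0 \<le> \<phi>" "\<phi> < 1"
    and "\<And>l. l \<in> S \<Longrightarrow> \<phi> \<le> f l" "sum f S \<le> 1"
  shows "1 - sum f S \<le> (\<Prod>l\<in>S. 1 - f l) * (1 - \<phi>\<^sup>2) ^ card {l\<in>S. Suc l \<in> S}"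
  using assms(1,4,5)
proof (induction S rule: finite_linorder_max_induct)
  case empty
  then show ?case by simp
next
  case (insert b S)
  let ?A = "1 - sum f S" and ?P = "\<lambda>S. \<Prod>l\<in>S. 1 - f l" and ?D = "\<lambda>S. {l\<in>S. Suc l \<in> S}"
  have b: "b \<notin> S" "\<phi> \<le> f b"
    using insert by auto
  have nn: "f l \<ge> 0" if "l \<in> S" for l
    using insert.prems(1)[of l] that assms(2) by auto
  have A: "?A \<ge> f b" "f b \<ge> 0"
    using insert.prems(2) b insert.hyps(1) assms(2) by auto
  have fb: "f b \<le> 1"
    using A sum_nonneg[of S f] nn by auto
  have IH: "?A \<le> ?P S * (1 - \<phi>\<^sup>2) ^ card (?D S)"
    using insert.prems A by (intro insert.IH) auto
  have \<phi>2: "\<phi>\<^sup>2 \<le> 1"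
    using assms(2,3) by (simp add: power_le_one)
  have top: "Suc b \<notin> insert b S"
    using insert.hyps(2) by force
  show ?case
  proof (cases "\<exists>a\<in>S. Suc a = b")
    case True
    then obtain a where a: "a \<in> S" "Suc a = b" by blast
    have D: "?D (insert b S) = insert a (?D S)"
      using a top by auto
    have "a \<notin> ?D S"
      using a b by auto
    then have cD: "card (?D (insert b S)) = Suc (card (?D S))"
      unfolding D using insert.hyps(1) by (intro card_insert_disjoint) auto
    have "f a \<le> sum f S"
      using a insert.hyps(1) nn by (intro member_le_sum) auto
    then have A1: "?A \<le> 1 - \<phi>"
      using insert.prems(1)[of a] a by auto
    have "f b * ?A \<le> f b * (1 - \<phi>)"
      using A1 A(2) by (rule mult_left_mono)
    then have "?A - f b \<le> ?A * (1 - f b / (1 - \<phi>))"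
      using assms(3) by (simp add: field_simps)
    also have "\<dots> \<le> ?A * ((1 - f b) * (1 - \<phi>\<^sup>2))"
    proof (rule mult_left_mono)
      have "\<phi> * f b \<ge> \<phi> * \<phi>" using b assms(2) by (intro mult_left_mono) auto
      moreover have "\<phi>\<^sup>2 * (1 - f b) * (1 - \<phi>) \<le> \<phi>\<^sup>2 * 1 * 1"
        using assms A fb by (intro mult_mono) auto
      ultimately have "\<phi>\<^sup>2 * (1 - f b) * (1 - \<phi>) \<le> \<phi> * f b" by (simp add: power2_eq_square)
      then show "1 - f b / (1 - \<phi>) \<le> (1 - f b) * (1 - \<phi>\<^sup>2)"
        using assms(3) by (simp add: field_simps)
    qed (use A in auto)
    also have "\<dots> \<le> (?P S * (1 - \<phi>\<^sup>2) ^ card (?D S)) * ((1 - f b) * (1 - \<phi>\<^sup>2))"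
      using IH fb \<phi>2 by (intro mult_right_mono) auto
    finally show ?thesis
      unfolding cD using b insert.hyps(1) by (simp add: algebra_simps)
  next
    case False
    have D: "?D (insert b S) = ?D S"
      using False top b by auto
    have "f b * ?A \<le> f b * 1"
      using nn A(2) by (intro mult_left_mono) (auto intro: sum_nonneg)
    then have "?A - f b \<le> ?A * (1 - f b)"
      by (simp add: algebra_simps)
    also have "\<dots> \<le> (?P S * (1 - \<phi>\<^sup>2) ^ card (?D S)) * (1 - f b)"
      using IH fb by (intro mult_right_mono) auto
    finally show ?thesis
      unfolding D using b insert.hyps(1) by (simp add: algebra_simps)
  qed
qed

section \<open>Greedy recolouring and the chain behind a missing colour\<close>

text \<open>A weight \<open>X v = (l, x)\<close> puts \<open>v\<close> into the long interval of colour \<open>l\<close> if \<open>x = 0\<close>, and at position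
  \<open>x\<close> of the short interval between the long intervals of colours \<open>l\<close> and \<open>l + 1\<close> otherwise. A stuck vertex
  of that short interval must receive colour \<open>l\<close>, as some edge has no other way to get it.\<close>

primrec stuck :: "'a set set \<Rightarrow> ('a \<Rightarrow> nat \<times> nat) \<Rightarrow> nat \<Rightarrow> 'a \<Rightarrow> bool" where
  "stuck \<E> X 0 v \<longleftrightarrow> (\<exists>e\<in>\<E>. v \<in> e \<and>
     (\<forall>u\<in>e. fst (X u) = 0 \<longrightarrow> 0 < snd (X u) \<and> snd (X u) \<le> snd (X v)))"
| "stuck \<E> X (Suc l) v \<longleftrightarrow> (\<exists>e\<in>\<E>. v \<in> e \<and>
     (\<forall>u\<in>e. fst (X u) = Suc l \<longrightarrow> 0 < snd (X u) \<and> snd (X u) \<le> snd (X v)) \<and>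
     (\<forall>u\<in>e. fst (X u) = l \<and> 0 < snd (X u) \<longrightarrow> stuck \<E> X l u))"

lemma stuck_iff:
  "stuck \<E> X i v \<longleftrightarrow> (\<exists>e\<in>\<E>. v \<in> e \<and>
     (\<forall>u\<in>e. fst (X u) = i \<longrightarrow> 0 < snd (X u) \<and> snd (X u) \<le> snd (X v)) \<and>
     (\<forall>u\<in>e. \<forall>l. i = Suc l \<and> fst (X u) = l \<and> 0 < snd (X u) \<longrightarrow> stuck \<E> X l u))"
  by (cases i) auto

text \<open>One function \<open>Y\<close> serves both sides: positions after \<open>Y l\<close> in
  the short interval \<open>l\<close> go to \<open>forbidden Y l\<close>, those before it to
  \<open>forbidden Y (Suc l)\<close>, and a positive position \<open>Y l\<close> itself to
  neither.\<close>

definition forbidden :: "(nat \<Rightarrow> nat) \<Rightarrow> nat \<Rightarrow> (nat \<times> nat) set" where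
  "forbidden Y l = {(l', x). l' = l \<and> (x = 0 \<or> Y l < x) \<or> Suc l' = l \<and> 0 < x \<and> x < Y l'}"

text \<open>Induction on the colour: the earliest vertex of \<open>e\<close> in the preceding short
  interval is stuck, and the edge that makes it stuck continues the chain. The bound
  \<open>b\<close> is the position of the vertex linking to the next edge, or 0 at the top.\<close>

lemma stuck_chain:
  fixes X :: "'a \<Rightarrow> nat \<times> nat"
  assumes "\<And>e. e \<in> \<E> \<Longrightarrow> finite e" "e \<in> \<E>"
    and "\<forall>u\<in>e. fst (X u) = i \<longrightarrow> 0 < snd (X u) \<and> snd (X u) \<le> b"
    and "\<forall>u\<in>e. \<forall>l. i = Suc l \<and> fst (X u) = l \<and> 0 < snd (X u) \<longrightarrow> stuck \<E> X l u"
  shows "\<exists>j\<le>i. \<exists>E V Y. Y i = b \<and> E i = e \<and> (\<forall>l<j. Y l = Suc m) \<and>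
     (\<forall>l\<in>{j..i}. E l \<in> \<E> \<and> (\<forall>u\<in>E l. X u \<notin> forbidden Y l)) \<and>
     (\<forall>l\<in>{j..<i}. V l \<in> E l \<inter> E (Suc l) \<and> X (V l) = (l, Y l) \<and> 0 < Y l)"
  using assms(2-)
proof (induction i arbitrary: e b)
  case 0
  have "X u \<notin> forbidden (\<lambda>_. b) 0" if "u \<in> e" for u
    using 0(2) that by (cases "X u") (auto simp: forbidden_def dest!: bspec[of e _ u])
  then show ?case
    using 0(1) by (intro exI[of _ 0] conjI exI[of _ "\<lambda>_. e"] exI[of _ "\<lambda>_. undefined :: 'a"]
        exI[of _ "\<lambda>_. b"]) auto
next
  case (Suc i)
  let ?T = "{u\<in>e. fst (X u) = i \<and> 0 < snd (X u)}"
  show ?case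
  proof (cases "?T = {}")
    case True
    \<comment> \<open>The chain ends here. As \<open>e\<close> has no vertex in the short interval
      \<open>i\<close>, any threshold works there; \<open>Suc m\<close> forbids all positions from 1
      to \<open>m\<close>.\<close>
    let ?Y = "\<lambda>l. if l \<le> i then Suc m else b"
    have "X u \<notin> forbidden ?Y (Suc i)" if "u \<in> e" for u
      using Suc.prems(2) True that by (cases "X u") (force simp: forbidden_def dest!: bspec[of e _ u])
    then show ?thesis
      using Suc.prems(1)
      by (intro exI[of _ "Suc i"] conjI exI[of _ "\<lambda>_. e"] exI[of _ "\<lambda>_. undefined :: 'a"]
        exI[of _ ?Y]) auto
  next
    case False
    have "finite ?T"
      using assms(1)[OF Suc.prems(1)] by simp
    \<comment> \<open>Minimality keeps \<open>e\<close> out of the part of the short interval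
      \<open>i\<close> before \<open>u\<close>, as the lower half of
      \<open>forbidden ?Y (Suc i)\<close> demands.\<close>
    then obtain u where u: "u \<in> ?T" and umin: "\<And>u'. u' \<in> ?T \<Longrightarrow> snd (X u) \<le> snd (X u')"
      using False arg_min_if_finite[of ?T "\<lambda>u. snd (X u)"] by (meson not_le)
    then have "stuck \<E> X i u"
      using Suc.prems(3) by auto
    then obtain e' where e': "e' \<in> \<E>" "u \<in> e'"
      "\<forall>v\<in>e'. fst (X v) = i \<longrightarrow> 0 < snd (X v) \<and> snd (X v) \<le> snd (X u)"
      "\<forall>v\<in>e'. \<forall>l. i = Suc l \<and> fst (X v) = l \<and> 0 < snd (X v) \<longrightarrow> stuck \<E> X l v"
      unfolding stuck_iff[of \<E> X i u] by blast
    from Suc.IH[OF e'(1,3,4)] obtain j E V Y where j: "j \<le> i"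
      and Y: "Y i = snd (X u)" "E i = e'" "\<forall>l<j. Y l = Suc m"
      and E: "\<forall>l\<in>{j..i}. E l \<in> \<E> \<and> (\<forall>u\<in>E l. X u \<notin> forbidden Y l)"
      and V: "\<forall>l\<in>{j..<i}. V l \<in> E l \<inter> E (Suc l) \<and> X (V l) = (l, Y l) \<and> 0 < Y l"
      by blast
    let ?E = "E(Suc i := e)" and ?V = "V(i := u)" and ?Y = "Y(Suc i := b)"
    have "X v \<notin> forbidden ?Y (Suc i)" if "v \<in> e" for v
      using Suc.prems(2) umin[of v] that Y(1)
      by (cases "X v") (auto simp: forbidden_def dest!: bspec[of e _ v])
    moreover have "forbidden ?Y l = forbidden Y l" if "l \<le> i" for l
      using that by (auto simp: forbidden_def)
    ultimately have EE: "\<forall>l\<in>{j..Suc i}. ?E l \<in> \<E> \<and> (\<forall>u\<in>?E l. X u \<notin> forbidden ?Y l)"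
      using E Suc.prems(1) by (auto simp: le_Suc_eq)
    have VV: "\<forall>l\<in>{j..<Suc i}. ?V l \<in> ?E l \<inter> ?E (Suc l) \<and> X (?V l) = (l, ?Y l) \<and> 0 < ?Y l"
      using V u e'(2) Y(1,2) by (auto simp: less_Suc_eq prod_eq_iff)
    have "?Y (Suc i) = b" "?E (Suc i) = e" "\<forall>l<j. ?Y l = Suc m" "j \<le> Suc i"
      using j Y by auto
    with EE VV show ?thesis by blast
  qed
qed

text \<open>Intervals are numbered from 0 and colours from 1, hence the extra \<open>Suc\<close>.
  The last row has no successor colour, so its vertices never move up.\<close>

definition interval_coloring :: "nat \<Rightarrow> 'a set set \<Rightarrow> ('a \<Rightarrow> nat \<times> nat) \<Rightarrow> 'a \<Rightarrow> nat" where
  "interval_coloring r \<E> X v =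
     (if snd (X v) = 0 \<or> Suc (fst (X v)) = r \<or> stuck \<E> X (fst (X v)) v
      then Suc (fst (X v)) else Suc (Suc (fst (X v))))"

text \<open>The edge \<open>e\<close> has no vertex in row \<open>i\<close> at all: otherwise
  \<open>e\<close> itself would make its last such vertex stuck, and that vertex would get the
  missing colour. So \<open>stuck_chain\<close> applies with bound 0.\<close>

lemma missing_color_chain:
  assumes fin: "\<And>e. e \<in> \<E> \<Longrightarrow> finite e" and e: "e \<in> \<E>" and i: "i < r"
    and missing: "\<And>u. u \<in> e \<Longrightarrow> interval_coloring r \<E> X u \<noteq> Suc i"
  shows "\<exists>j\<le>i. \<exists>E V Y. Y i = 0 \<and> (\<forall>l<j. Y l = Suc m) \<and>
     (\<forall>l\<in>{j..i}. E l \<in> \<E> \<and> (\<forall>u\<in>E l. X u \<notin> forbidden Y l)) \<and>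
     (\<forall>l\<in>{j..<i}. V l \<in> E l \<inter> E (Suc l) \<and> X (V l) = (l, Y l) \<and> 0 < Y l)"
proof -
  have st: "stuck \<E> X l u" if "u \<in> e" "i = Suc l" "fst (X u) = l" "0 < snd (X u)" for u l
    using missing[OF that(1)] that i by (auto simp: interval_coloring_def split: if_splits)
  have none: "fst (X u) \<noteq> i" if "u \<in> e" for u
  proof
    assume u: "fst (X u) = i"
    let ?T = "{u\<in>e. fst (X u) = i}"
    have "finite ?T" "?T \<noteq> {}"
      using fin[OF e] that u by auto
    then have "Max ((\<lambda>u. snd (X u)) ` ?T) \<in> (\<lambda>u. snd (X u)) ` ?T"
      by (intro Max_in) auto
    then obtain v where v: "v \<in> e" "fst (X v) = i" "snd (X v) = Max ((\<lambda>u. snd (X u)) ` ?T)"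
      by auto
    have "\<forall>u\<in>e. fst (X u) = i \<longrightarrow> 0 < snd (X u) \<and> snd (X u) \<le> snd (X v)"
    proof (intro ballI impI conjI)
      fix u assume u: "u \<in> e" "fst (X u) = i"
      then show "0 < snd (X u)"
        using missing[of u] by (auto simp: interval_coloring_def split: if_splits)
      show "snd (X u) \<le> snd (X v)"
        unfolding v(3) using u \<open>finite ?T\<close> by (intro Max_ge) auto
    qed
    then have "stuck \<E> X i v"
      unfolding stuck_iff[of \<E> X i v] using e v(1) st by blast
    then show False
      using missing[OF v(1)] v(2) by (simp add: interval_coloring_def)
  qed
  have "\<exists>j\<le>i. \<exists>E V Y. Y i = 0 \<and> E i = e \<and> (\<forall>l<j. Y l = Suc m) \<and>
     (\<forall>l\<in>{j..i}. E l \<in> \<E> \<and> (\<forall>u\<in>E l. X u \<notin> forbidden Y l)) \<and>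
     (\<forall>l\<in>{j..<i}. V l \<in> E l \<inter> E (Suc l) \<and> X (V l) = (l, Y l) \<and> 0 < Y l)"
    using none st by (intro stuck_chain fin e) auto
  then show ?thesis by blast
qed

section \<open>Estimates for the probability of a single chain\<close>

lemma exp_neg_le_one_minus:
  fixes x :: real
  assumes "x < 1"
  shows "exp (- (x / (1 - x))) \<le> 1 - x"
proof -
  have "1 / (1 - x) = 1 + x / (1 - x)"
    using assms by (simp add: field_simps)
  also have "\<dots> \<le> exp (x / (1 - x))"
    by (rule exp_ge_add_one_self)
  finally show ?thesis
    using assms by (simp add: exp_minus field_simps)
qed

text \<open>The maximum of \<open>t * exp (- g * t)\<close> is at \<open>t = 1 / g\<close>. With
  \<open>t\<close> common vertices of consecutive edges, this pays for choosing one of them.\<close>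

lemma mult_power_one_minus_le:
  fixes g :: real
  assumes "0 < g" "g \<le> 1"
  shows "real t * (1 - g) ^ t \<le> exp (- 1) / g"
proof -
  have "(1 - g) ^ t \<le> exp (- g) ^ t"
    using assms exp_ge_add_one_self[of "- g"] by (intro power_mono) auto
  then have "real t * (1 - g) ^ t \<le> real t * exp (- (g * real t))"
    by (simp add: mult_left_mono mult.commute flip: exp_of_nat_mult)
  also have "g * \<dots> \<le> exp (g * real t - 1) * exp (- (g * real t))"
    using exp_ge_add_one_self[of "g * real t - 1"] by simp
  then have "real t * exp (- (g * real t)) \<le> exp (- 1) / g"
    using assms by (simp add: field_simps flip: exp_add)
  finally show ?thesis .
qed

text \<open>Each vertex is charged a factor \<open>H u\<close> from the edges and adjacent pairs
  containing it. A linking vertex is only known to have \<open>b u \<le> c\<close>, but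
  \<open>1 \<le> K * H u\<close> lets it be charged \<open>H u\<close> as well at the price
  \<open>c * K\<close>. Exchanging products over vertices and edges then gives the powers.\<close>

lemma prod_chain_le:
  fixes f :: "nat \<Rightarrow> real" and b :: "'a \<Rightarrow> real" and E :: "nat \<Rightarrow> 'a set"
  assumes "finite W" "j \<le> i" "i < r" "0 \<le> \<phi>" "\<phi> < 1" "0 \<le> c"
    and f: "\<And>l. l \<in> {j..i} \<Longrightarrow> \<phi> \<le> f l \<and> f l \<le> \<psi>" and "\<psi> < 1"
    and E: "\<And>l. l \<in> {j..i} \<Longrightarrow> E l \<subseteq> W \<and> card (E l) = n"
    and V: "\<And>l. l \<in> {j..<i} \<Longrightarrow> V l \<in> W \<and> b (V l) \<le> c" and "inj_on V {j..<i}"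
    and b: "\<And>u. u \<in> W \<Longrightarrow> 0 \<le> b u \<and> b u \<le> 1 - (\<Sum>l | l \<in> {j..i} \<and> u \<in> E l. f l)"
    and K: "1 \<le> K * ((1 - \<psi>) * (1 - \<phi>\<^sup>2)) ^ r" "0 \<le> K"
  shows "(\<Prod>u\<in>W. b u) \<le> (c * K) ^ (i - j) * (\<Prod>l\<in>{j..i}. (1 - f l)) ^ n *
    (\<Prod>l\<in>{j..<i}. (1 - \<phi>\<^sup>2) ^ card (E l \<inter> E (Suc l)))"
proof -
  define S where "S u = {l \<in> {j..i}. u \<in> E l}" for u
  define D where "D u = {l \<in> {j..<i}. u \<in> E l \<inter> E (Suc l)}" for u
  define H where "H u = (\<Prod>l\<in>S u. 1 - f l) * (\<Prod>l\<in>D u. 1 - \<phi>\<^sup>2)" for u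
  have g: "0 < 1 - \<phi>\<^sup>2" "1 - \<phi>\<^sup>2 \<le> 1"
    using assms(4,5) by (auto simp: power_strict_mono abs_square_less_1)
  have f1: "0 < 1 - f l" "1 - f l \<le> 1" if "l \<in> {j..i}" for l
    using f[OF that] assms(4) \<open>\<psi> < 1\<close> by auto
  have H_pos: "0 < H u" for u
    unfolding H_def S_def using g f1 by (intro mult_pos_pos prod_pos) auto
  have bH: "b u \<le> H u" if "u \<in> W" for u
  proof -
    have "b u \<le> 1 - sum f (S u)"
      using b[OF that] by (simp add: S_def)
    also have "\<dots> \<le> (\<Prod>l\<in>S u. 1 - f l) * (1 - \<phi>\<^sup>2) ^ card {l\<in>S u. Suc l \<in> S u}"
      using assms(4,5) f b[OF that]
      by (intro one_minus_sum_le_prod_adjacent) (auto simp: S_def)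
    also have "{l\<in>S u. Suc l \<in> S u} = D u"
      by (auto simp: S_def D_def)
    finally show ?thesis
      by (simp add: H_def)
  qed
  have KH: "1 \<le> K * H u" for u
  proof -
    have "card (S u) \<le> card {j..i}" "card (D u) \<le> card {j..<i}"
      unfolding S_def D_def by (intro card_mono; auto)+
    then have cards: "card (S u) \<le> r" "card (D u) \<le> r"
      using assms(3) by auto
    have psi: "0 < 1 - \<psi>" "1 - \<psi> \<le> 1"
      using f[of i] assms(2,4) \<open>\<psi> < 1\<close> by auto
    have "(1 - \<psi>) ^ r \<le> (1 - \<psi>) ^ card (S u)"
      using psi cards by (intro power_decreasing) auto
    also have "\<dots> = (\<Prod>l\<in>S u. 1 - \<psi>)"
      by simp
    also have "\<dots> \<le> (\<Prod>l\<in>S u. 1 - f l)"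
      using f psi by (intro prod_mono) (auto simp: S_def)
    finally have "((1 - \<psi>) * (1 - \<phi>\<^sup>2)) ^ r \<le> H u"
      unfolding H_def power_mult_distrib using g psi cards
      by (intro mult_mono) (auto intro!: power_decreasing prod_nonneg less_imp_le[OF f1(1)] simp: S_def)
    then show ?thesis
      using K mult_left_mono by fastforce
  qed
  let ?VI = "V ` {j..<i}"
  have "(\<Prod>u\<in>W. b u) \<le> (\<Prod>u\<in>W. (if u \<in> ?VI then c * K else 1) * H u)"
  proof (intro prod_mono conjI)
    fix u assume u: "u \<in> W"
    show "b u \<le> (if u \<in> ?VI then c * K else 1) * H u"
    proof (cases "u \<in> ?VI")
      case True
      then have "b u \<le> c * 1"
        using V by auto
      also have "\<dots> \<le> c * (K * H u)"
        using KH assms(6) by (intro mult_left_mono)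
      finally show ?thesis
        using True by (simp add: mult.assoc)
    qed (use bH[OF u] in auto)
  qed (use b in auto)
  also have "\<dots> = (c * K) ^ card ?VI * (\<Prod>u\<in>W. H u)"
  proof -
    have "W \<inter> ?VI = ?VI"
      using V by auto
    then show ?thesis
      using assms(1) by (simp add: prod.distrib prod.If_cases)
  qed
  also have "card ?VI = i - j"
    using assms(11) by (simp add: card_image)
  also have "(\<Prod>u\<in>W. H u) = (\<Prod>u\<in>W. \<Prod>l\<in>S u. 1 - f l) * (\<Prod>u\<in>W. \<Prod>l\<in>D u. 1 - \<phi>\<^sup>2)"
    by (simp add: H_def prod.distrib)
  also have "(\<Prod>u\<in>W. \<Prod>l\<in>S u. 1 - f l) = (\<Prod>l\<in>{j..i}. \<Prod>u | u \<in> W \<and> u \<in> E l. 1 - f l)"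
    unfolding S_def using assms(1) by (intro prod.swap_restrict) auto
  also have "\<dots> = (\<Prod>l\<in>{j..i}. 1 - f l) ^ n"
    unfolding prod_power_distrib
  proof (intro prod.cong refl)
    fix l assume l: "l \<in> {j..i}"
    then have "{u \<in> W. u \<in> E l} = E l"
      using E by auto
    then show "(\<Prod>u | u \<in> W \<and> u \<in> E l. 1 - f l) = (1 - f l) ^ n"
      using E[OF l] by simp
  qed
  also have "(\<Prod>u\<in>W. \<Prod>l\<in>D u. 1 - \<phi>\<^sup>2) =
      (\<Prod>l\<in>{j..<i}. \<Prod>u | u \<in> W \<and> u \<in> E l \<inter> E (Suc l). 1 - \<phi>\<^sup>2)"
    unfolding D_def using assms(1) by (intro prod.swap_restrict) auto
  also have "\<dots> = (\<Prod>l\<in>{j..<i}. (1 - \<phi>\<^sup>2) ^ card (E l \<inter> E (Suc l)))"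
  proof (intro prod.cong refl)
    fix l assume l: "l \<in> {j..<i}"
    then have "{u \<in> W. u \<in> E l \<inter> E (Suc l)} = E l \<inter> E (Suc l)"
      using E[of l] by auto
    then show "(\<Prod>u | u \<in> W \<and> u \<in> E l \<inter> E (Suc l). 1 - \<phi>\<^sup>2) = (1 - \<phi>\<^sup>2) ^ card (E l \<inter> E (Suc l))"
      by simp
  qed
  finally show ?thesis
    by (simp add: mult.assoc)
qed

section \<open>The interval weights and the probabilities of the forbidden sets\<close>

text \<open>The first and the last long interval lose only \<open>q / 2\<close>, the others \<open>q\<close>. Then every chain that does not run
  through all colours has forbidden sets of total excess at least \<open>q / 2\<close> (up to discretisation), and the
  full chain has excess zero.\<close>

locale interval_weights =
  fixes r m :: nat and q :: real
  assumes r: "2 \<le> r" and m: "0 < m" and q: "0 \<le> q" "200 * real r * q \<le> 1"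
begin

text \<open>Length 0 in the last row, like \<open>prev_short 0 = 0\<close>, gives all rows the same
  shape; the positions there exist in \<open>\<Omega>\<close> but carry no weight.\<close>

definition short :: "nat \<Rightarrow> real" where
  "short l = (if Suc l < r then q else 0)"

definition prev_short :: "nat \<Rightarrow> real" where
  "prev_short l = (case l of 0 \<Rightarrow> 0 | Suc k \<Rightarrow> short k)"

definition weight :: "nat \<times> nat \<Rightarrow> real" where
  "weight = (\<lambda>(l, x). if x = 0 then 1 / real r - (short l + prev_short l) / 2 else short l / real m)"

definition \<Omega> :: "(nat \<times> nat) set" where
  "\<Omega> = {..<r} \<times> {..m}"

lemma finite_\<Omega>: "finite \<Omega>"
  by (simp add: \<Omega>_def)

lemma short_bounds: "0 \<le> short l" "short l \<le> q" "0 \<le> prev_short l" "prev_short l \<le> q"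
  using q by (auto simp: short_def prev_short_def split: nat.splits)

lemma q_le: "q \<le> 1 / (200 * real r)"
  using q r by (simp add: field_simps)

lemma weight_nonneg: "0 \<le> weight \<omega>"
proof -
  have "q \<le> 1 / real r"
    using q_le r by (simp add: field_simps)
  then show ?thesis
    using short_bounds[of "fst \<omega>"] by (auto simp: weight_def split: prod.split)
qed

lemma sum_weight: "sum weight \<Omega> = 1"
proof -
  have row: "(\<Sum>x\<le>m. weight (l, x)) = 1 / real r - (short l + prev_short l) / 2 + short l" for l
  proof -
    have "(\<Sum>x\<le>m. weight (l, x)) = weight (l, 0) + (\<Sum>x\<in>{1..m}. weight (l, x))"
      by (simp add: atMost_atLeast0 sum.atLeast_Suc_atMost)
    also have "\<dots> = 1 / real r - (short l + prev_short l) / 2 + short l"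
      using m by (simp add: weight_def)
    finally show ?thesis .
  qed
  have tele: "(\<Sum>l<k. short l - prev_short l) = prev_short k" for k
    by (induction k) (auto simp: prev_short_def)
  have "prev_short r = 0"
    unfolding prev_short_def short_def by (simp split: nat.split)
  have "sum weight \<Omega> = (\<Sum>l<r. \<Sum>x\<le>m. weight (l, x))"
    by (simp add: \<Omega>_def sum.cartesian_product)
  also have "\<dots> = (\<Sum>l<r. 1 / real r + (short l - prev_short l) / 2)"
    unfolding row by (intro sum.cong) (auto simp: field_simps)
  also have "\<dots> = 1 + (\<Sum>l<r. short l - prev_short l) / 2"
    using r by (simp add: sum.distrib flip: sum_divide_distrib)
  also have "\<dots> = 1"
    using tele[of r] \<open>prev_short r = 0\<close> by simp
  finally show ?thesis .
qed

text \<open>The \<open>- 1\<close> comes from the strict inequality \<open>x < Y l'\<close>. For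
  \<open>l = 0\<close> the truncated index \<open>l - 1\<close> is harmless because
  \<open>prev_short 0 = 0\<close>.\<close>

lemma sum_weight_forbidden:
  assumes "l < r" "Y l \<le> m" "\<And>k. l = Suc k \<Longrightarrow> 0 < Y k \<and> Y k \<le> Suc m"
  shows "sum weight (\<Omega> \<inter> forbidden Y l) = 1 / real r +
     short l * (1 / 2 - real (Y l) / real m) +
     prev_short l * ((real (Y (l - 1)) - 1) / real m - 1 / 2)"
proof -
  have weight_zero: "weight (l, 0) = 1 / real r - (short l + prev_short l) / 2"
    by (simp add: weight_def)
  define P where "P = (case l of 0 \<Rightarrow> {} | Suc k \<Rightarrow> Pair k ` {0<..<Y k})"
  have eq: "\<Omega> \<inter> forbidden Y l = insert (l, 0) (Pair l ` {Y l<..m} \<union> P)"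
    using assms by (auto simp: \<Omega>_def forbidden_def P_def split: nat.splits)
  have fin: "finite P"
    by (auto simp: P_def split: nat.split)
  have disj: "(l, 0) \<notin> Pair l ` {Y l<..m} \<union> P" "Pair l ` {Y l<..m} \<inter> P = {}"
    by (auto simp: P_def split: nat.splits)
  have "sum weight P = prev_short l * ((real (Y (l - 1)) - 1) / real m)"
  proof (cases l)
    case (Suc k)
    have "sum weight P = (\<Sum>x\<in>{0<..<Y k}. weight (k, x))"
      by (simp add: P_def Suc sum.reindex inj_on_def)
    also have "\<dots> = (\<Sum>x\<in>{0<..<Y k}. short k / real m)"
      by (intro sum.cong) (auto simp: weight_def)
    finally show ?thesis
      using assms(3)[OF Suc] by (simp add: Suc prev_short_def of_nat_diff)
  qed (simp add: P_def prev_short_def)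
  moreover have "sum weight (Pair l ` {Y l<..m}) = short l * (1 - real (Y l) / real m)"
  proof -
    have "sum weight (Pair l ` {Y l<..m}) = (\<Sum>x\<in>{Y l<..m}. weight (l, x))"
      by (simp add: sum.reindex inj_on_def)
    also have "\<dots> = (\<Sum>x\<in>{Y l<..m}. short l / real m)"
      by (intro sum.cong) (auto simp: weight_def)
    finally show ?thesis
      using assms(2) m by (simp add: of_nat_diff field_simps)
  qed
  ultimately show ?thesis
    unfolding eq using disj fin
    by (simp add: sum.union_disjoint) (simp add: weight_zero algebra_simps add_divide_distrib)
qed

lemma forbidden_disjoint: "k \<noteq> l \<Longrightarrow> forbidden Y k \<inter> forbidden Y l = {}"
  by (auto simp: forbidden_def)

text \<open>This extends link positions \<open>y\<close> on \<open>{j..<i}\<close> by the end values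
  of a chain: \<open>Suc m\<close> forbids the whole short interval before row \<open>j\<close>, and
  0 the whole one after row \<open>i\<close>.\<close>

definition thresholds :: "nat \<Rightarrow> nat \<Rightarrow> (nat \<Rightarrow> nat) \<Rightarrow> nat \<Rightarrow> nat" where
  "thresholds j i y l = (if l < j then Suc m else if l < i then y l else 0)"

abbreviation prob_forbidden :: "(nat \<Rightarrow> nat) \<Rightarrow> nat \<Rightarrow> real" where
  "prob_forbidden Y l \<equiv> sum weight (\<Omega> \<inter> forbidden Y l)"

lemma prob_forbidden_eq:
  assumes "j \<le> i" "i < r" "y \<in> {j..<i} \<rightarrow> {1..m}" "l \<in> {j..i}"
  shows "prob_forbidden (thresholds j i y) l = 1 / real r +
     short l * (1 / 2 - real (thresholds j i y l) / real m) +
     prev_short l * ((real (thresholds j i y (l - 1)) - 1) / real m - 1 / 2)"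
proof (rule sum_weight_forbidden)
  show "thresholds j i y l \<le> m"
    using assms by (auto simp: thresholds_def Pi_def)
  fix k assume "l = Suc k"
  then show "0 < thresholds j i y k \<and> thresholds j i y k \<le> Suc m"
    using assms(3)[THEN Pi_mem, of k] assms(4) by (auto simp: thresholds_def)
qed (use assms in auto)

text \<open>Each of the two corrections to \<open>1 / r\<close> is at most \<open>q / 2\<close> in
  absolute value, and \<open>q \<le> 1 / (200 * r)\<close>. The lower bound is rounded down.\<close>

lemma prob_forbidden_bounds:
  assumes "j \<le> i" "i < r" "y \<in> {j..<i} \<rightarrow> {1..m}" "l \<in> {j..i}"
  shows "19 / (20 * real r) \<le> prob_forbidden (thresholds j i y) l"
    and "prob_forbidden (thresholds j i y) l \<le> 201 / (200 * real r)"
proof -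
  let ?Y = "thresholds j i y"
  let ?a = "1 / 2 - real (?Y l) / real m"
  have Yl: "?Y l \<le> m"
    using assms by (auto simp: thresholds_def Pi_def)
  then have a: "\<bar>?a\<bar> \<le> 1 / 2"
    using m by (auto simp: abs_le_iff field_simps)
  have sa: "\<bar>short l * ?a\<bar> \<le> q * (1 / 2)"
    unfolding abs_mult using a short_bounds[of l] by (intro mult_mono) auto
  let ?b = "(real (?Y (l - 1)) - 1) / real m - 1 / 2"
  have sb: "\<bar>prev_short l * ?b\<bar> \<le> q * (1 / 2)"
  proof (cases l)
    case (Suc k)
    then have "0 < ?Y k \<and> ?Y k \<le> Suc m"
      using assms(3)[THEN Pi_mem, of k] assms(4) by (auto simp: thresholds_def)
    then have "\<bar>?b\<bar> \<le> 1 / 2"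
      using m Suc by (auto simp: abs_le_iff field_simps)
    then show ?thesis
      unfolding abs_mult using short_bounds[of l] by (intro mult_mono) auto
  qed (use q in \<open>simp add: prev_short_def\<close>)
  have "\<bar>prob_forbidden ?Y l - 1 / real r\<bar> \<le> q"
    unfolding prob_forbidden_eq[OF assms] using sa sb by linarith
  moreover have "1 / real r - 19 / (20 * real r) \<ge> 1 / (200 * real r)"
    "201 / (200 * real r) - 1 / real r = 1 / (200 * real r)"
    using r by (auto simp: field_simps)
  ultimately show "19 / (20 * real r) \<le> prob_forbidden ?Y l" "prob_forbidden ?Y l \<le> 201 / (200 * real r)"
    using q_le by linarith+
qed

text \<open>The threshold \<open>Y l\<close> enters the terms \<open>l\<close> and
  \<open>Suc l\<close> with opposite signs and cancels; each link leaves only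
  \<open>- q / m\<close>, the weight of the linking position. The two ends contribute half a short
  interval each.\<close>

lemma sum_prob_forbidden:
  assumes "j \<le> i" "i < r" "y \<in> {j..<i} \<rightarrow> {1..m}"
  shows "(\<Sum>l\<in>{j..i}. prob_forbidden (thresholds j i y) l - 1 / real r) =
    (short i + prev_short j) / 2 - real (i - j) * (q / real m)"
proof -
  let ?Y = "thresholds j i y"
  define A where "A l = short l * (1 / 2 - real (?Y l) / real m)" for l
  define B where "B l = prev_short l * ((real (?Y (l - 1)) - 1) / real m - 1 / 2)" for l
  have AB: "A l + B (Suc l) = - (q / real m)" if "l < i" for l
    using that assms(2) m by (simp add: A_def B_def prev_short_def short_def divide_simps) (simp add: algebra_simps)
  have "(\<Sum>l\<in>{j..i}. prob_forbidden ?Y l - 1 / real r) = (\<Sum>l\<in>{j..i}. A l + B l)"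
    using prob_forbidden_eq[OF assms] by (intro sum.cong) (auto simp: A_def B_def)
  also have "\<dots> = (\<Sum>l\<in>{j..<i}. A l + B (Suc l)) + A i + B j"
  proof -
    have "(\<Sum>l\<in>{j..i}. A l) = (\<Sum>l\<in>{j..<i}. A l) + A i"
      using assms(1) by (simp add: sum.last_plus add.commute)
    moreover have "(\<Sum>l\<in>{j..i}. B l) = B j + (\<Sum>l\<in>{j..<i}. B (Suc l))"
      using assms(1) by (simp add: sum.atLeast_Suc_atMost sum.shift_bounds_Suc_ivl[symmetric] atLeastLessThanSuc_atLeastAtMost)
    ultimately show ?thesis
      by (simp add: sum.distrib)
  qed
  also have "(\<Sum>l\<in>{j..<i}. A l + B (Suc l)) = - (real (i - j) * (q / real m))"
    using AB by simp
  also have "A i = short i / 2"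
    using assms(1) by (simp add: A_def thresholds_def)
  also have "B j = prev_short j / 2"
    using m by (cases j) (simp_all add: B_def thresholds_def prev_short_def)
  finally show ?thesis
    by (simp add: field_simps)
qed

text \<open>Factoring \<open>1 - 1 / r\<close> out of each term and applying
  \<open>1 + x \<le> exp x\<close> leaves only the sum of the excesses, which does not depend on
  \<open>y\<close>.\<close>

lemma prod_prob_forbidden:
  assumes "j \<le> i" "i < r" "y \<in> {j..<i} \<rightarrow> {1..m}"
  shows "(\<Prod>l\<in>{j..i}. 1 - prob_forbidden (thresholds j i y) l) \<le> (1 - 1 / real r) ^ Suc (i - j) *
    exp (- (real r / (real r - 1)) * ((short i + prev_short j) / 2 - real (i - j) * (q / real m)))"
proof -
  let ?f = "prob_forbidden (thresholds j i y)"
  have "(\<Prod>l\<in>{j..i}. 1 - ?f l) \<le>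
      (\<Prod>l\<in>{j..i}. (1 - 1 / real r) * exp (- (real r / (real r - 1)) * (?f l - 1 / real r)))"
  proof (intro prod_mono conjI)
    fix l assume l: "l \<in> {j..i}"
    have "201 / (200 * real r) \<le> 1"
      using r by simp
    then show "0 \<le> 1 - ?f l"
      using prob_forbidden_bounds(2)[OF assms l] by linarith
    have "1 - ?f l = (1 - 1 / real r) * (1 + - (real r / (real r - 1)) * (?f l - 1 / real r))"
      using r by (simp add: field_simps)
    also have "\<dots> \<le> (1 - 1 / real r) * exp (- (real r / (real r - 1)) * (?f l - 1 / real r))"
      using r by (intro mult_left_mono exp_ge_add_one_self) auto
    finally show "1 - ?f l \<le> \<dots>" .
  qed
  also have "\<dots> = (1 - 1 / real r) ^ Suc (i - j) *
      exp (- (real r / (real r - 1)) * (\<Sum>l\<in>{j..i}. ?f l - 1 / real r))"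
    using assms(1) by (simp only: prod.distrib exp_sum[symmetric, OF finite_atLeastAtMost]
      sum_distrib_left[symmetric] prod_constant card_atLeastAtMost Suc_diff_le)
  finally show ?thesis
    unfolding sum_prob_forbidden[OF assms] .
qed

text \<open>This provides \<open>K\<close> for \<open>prod_chain_le\<close>. The two factors cost
  exponents of at most 203/100 and 87/100. After \<open>exp (- 1)\<close> from
  \<open>mult_power_one_minus_le\<close>, the value 29/10 leaves room 1/10 below exponent 2 for the
  discretisation.\<close>

lemma vertex_loss:
  "1 \<le> exp (29 / 10) * ((1 - 201 / (200 * real r)) * (1 - (19 / (20 * real r))\<^sup>2)) ^ r"
proof -
  let ?\<psi> = "201 / (200 * real r)" and ?g = "(19 / (20 * real r))\<^sup>2"
  have r2: "real r \<ge> 2"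
    using r by simp
  have "2 * real r \<le> real r * real r"
    using r2 by simp
  then have "361 < 400 * (real r * real r)"
    using r2 by linarith
  then have "?\<psi> < 1" "?g < 1"
    using r2 by (auto simp: power2_eq_square field_simps)
  moreover have "real r * (?\<psi> / (1 - ?\<psi>)) \<le> 203 / 100"
    using r2 by (simp add: field_simps)
  moreover have "real r * (?g / (1 - ?g)) \<le> 87 / 100"
  proof -
    have "?g / (1 - ?g) = 361 / (400 * real r * real r - 361)"
      using r2 \<open>?g < 1\<close> by (simp add: power2_eq_square field_simps)
    moreover have "361 * real r \<le> 87 / 100 * (400 * real r * real r - 361)"
    proof -
      have "361 * x \<le> 87 / 100 * (400 * x * x - 361)" if "2 \<le> x" "2 * x \<le> x * x" for x :: real
      proof -
        have "361 * x \<le> 348 * (x * x) - 87 / 100 * 361"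
          using that by linarith
        then show ?thesis by (simp add: algebra_simps)
      qed
      then show ?thesis
        using r2 \<open>2 * real r \<le> real r * real r\<close> by blast
    qed
    ultimately show ?thesis
      using \<open>361 < 400 * (real r * real r)\<close> by (simp add: pos_divide_le_eq)
  qed
  ultimately have "- (29 / 10) \<le> real r * (- (?\<psi> / (1 - ?\<psi>)) + - (?g / (1 - ?g)))"
    unfolding distrib_left mult_minus_right by linarith
  then have "exp (- (29 / 10)) \<le> exp (real r * (- (?\<psi> / (1 - ?\<psi>)) + - (?g / (1 - ?g))))"
    by simp
  also have "\<dots> = (exp (- (?\<psi> / (1 - ?\<psi>))) * exp (- (?g / (1 - ?g)))) ^ r"
    by (simp only: exp_of_nat_mult exp_add)
  also have "\<dots> \<le> ((1 - ?\<psi>) * (1 - ?g)) ^ r"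
    using \<open>?\<psi> < 1\<close> \<open>?g < 1\<close> by (intro power_mono mult_mono exp_neg_le_one_minus) auto
  finally show ?thesis
    by (simp add: exp_minus field_simps)
qed

section \<open>Boxes of chains, their total probability, and the covering property\<close>

definition chain_box ::
  "nat \<Rightarrow> nat \<Rightarrow> (nat \<Rightarrow> 'a set) \<Rightarrow> (nat \<Rightarrow> 'a) \<Rightarrow> (nat \<Rightarrow> nat) \<Rightarrow> 'a \<Rightarrow> (nat \<times> nat) set"
  where "chain_box j i E V y u = {\<omega>\<in>\<Omega>.
    (\<forall>l\<in>{j..i}. u \<in> E l \<longrightarrow> \<omega> \<notin> forbidden (thresholds j i y) l) \<and>
    (\<forall>l\<in>{j..<i}. V l = u \<longrightarrow> \<omega> = (l, y l))}"

lemma prod_chain_box_le: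
  fixes E :: "nat \<Rightarrow> 'a set"
  assumes ji: "j \<le> i" "i < r" and y: "y \<in> {j..<i} \<rightarrow> {1..m}" and "finite W"
    and E: "\<And>l. l \<in> {j..i} \<Longrightarrow> E l \<subseteq> W \<and> card (E l) = n"
    and V: "\<And>l. l \<in> {j..<i} \<Longrightarrow> V l \<in> E l"
  shows "(\<Prod>u\<in>W. sum weight (chain_box j i E V y u)) \<le>
    (q / real m * exp (29 / 10)) ^ (i - j) *
    ((1 - 1 / real r) ^ Suc (i - j) * exp (- (real r / (real r - 1)) *
        ((short i + prev_short j) / 2 - real (i - j) * (q / real m)))) ^ n *
    (\<Prod>l\<in>{j..<i}. (1 - (19 / (20 * real r))\<^sup>2) ^ card (E l \<inter> E (Suc l)))"
    (is "?L \<le> ?c * ?M ^ n * ?T")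
proof -
  let ?b = "\<lambda>u. sum weight (chain_box j i E V y u)"
  let ?f = "prob_forbidden (thresholds j i y)" and ?F = "forbidden (thresholds j i y)"
  have psi: "201 / (200 * real r) < 1" "19 / (20 * real r) < 1" "0 \<le> 19 / (20 * real r)"
    using r by auto
  have f0: "0 \<le> 1 - ?f l" if "l \<in> {j..i}" for l
    using prob_forbidden_bounds(2)[OF ji y that] psi by linarith
  have T: "0 \<le> ?T"
    using psi by (intro prod_nonneg zero_le_power) (auto simp: power_le_one)
  have VW: "V l \<in> W" if "l \<in> {j..<i}" for l
    using V[OF that] E[of l] that by auto
  have b0: "0 \<le> ?b u" for u
    by (intro sum_nonneg weight_nonneg)
  show ?thesis
  proof (cases "inj_on V {j..<i}")
    case True
    have "?L \<le> (q / real m * exp (29 / 10)) ^ (i - j) * (\<Prod>l\<in>{j..i}. 1 - ?f l) ^ n * ?T"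
    proof (rule prod_chain_le[where b = ?b and r = r and \<psi> = "201 / (200 * real r)"])
      fix l assume "l \<in> {j..i}"
      then show "19 / (20 * real r) \<le> ?f l \<and> ?f l \<le> 201 / (200 * real r)"
        using prob_forbidden_bounds[OF ji y] by blast
    next
      fix l assume l: "l \<in> {j..<i}"
      have "?b (V l) \<le> sum weight {(l, y l)}"
        using l by (intro sum_mono2 weight_nonneg) (auto simp: chain_box_def)
      also have "\<dots> \<le> q / real m"
        using y[THEN Pi_mem, OF l] short_bounds(2)[of l] by (simp add: weight_def divide_right_mono)
      finally show "V l \<in> W \<and> ?b (V l) \<le> q / real m"
        using VW[OF l] by simp
    next
      fix u assume "u \<in> W"
      let ?S = "{l. l \<in> {j..i} \<and> u \<in> E l}"
      \<comment> \<open>The forbidden sets of the edges through \<open>u\<close> are disjoint from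
        each other and from the box of \<open>u\<close>, so their weights add up to at most
        1.\<close>
      have "sum weight (\<Union>l\<in>?S. \<Omega> \<inter> ?F l) = (\<Sum>l\<in>?S. ?f l)"
      proof (intro sum.UNION_disjoint ballI impI)
        fix k l :: nat assume "k \<noteq> l"
        then show "\<Omega> \<inter> ?F k \<inter> (\<Omega> \<inter> ?F l) = {}"
          using forbidden_disjoint[of k l] by blast
      qed (use finite_\<Omega> in auto)
      moreover have "sum weight (chain_box j i E V y u) + sum weight (\<Union>l\<in>?S. \<Omega> \<inter> ?F l) =
          sum weight (chain_box j i E V y u \<union> (\<Union>l\<in>?S. \<Omega> \<inter> ?F l))"
        using finite_\<Omega> by (intro sum.union_disjoint[symmetric]) (auto simp: chain_box_def)
      moreover have "\<dots> \<le> sum weight \<Omega>"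
        using finite_\<Omega> by (intro sum_mono2 weight_nonneg) (auto simp: chain_box_def)
      ultimately show "0 \<le> ?b u \<and> ?b u \<le> 1 - (\<Sum>l\<in>?S. ?f l)"
        using b0 sum_weight by simp
    qed (use assms psi q True E VW vertex_loss in auto)
    also have "\<dots> \<le> ?c * ?M ^ n * ?T"
      using f0 q T by (intro mult_right_mono mult_left_mono power_mono prod_prob_forbidden ji y)
        (auto intro!: prod_nonneg)
    finally show ?thesis .
  next
    case False
    then obtain k l where kl: "k \<in> {j..<i}" "l \<in> {j..<i}" "k \<noteq> l" "V k = V l"
      by (auto simp: inj_on_def)
    \<comment> \<open>A vertex used for two links would have to lie in two different short
      intervals, so its box is empty and the product vanishes.\<close>
    have "\<omega> \<notin> chain_box j i E V y (V l)" for \<omega>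
    proof
      assume "\<omega> \<in> chain_box j i E V y (V l)"
      then have "\<omega> = (l', y l')" if "l' \<in> {j..<i}" "V l' = V l" for l'
        using that by (simp add: chain_box_def)
      from this[OF kl(1,4)] this[OF kl(2)] kl(3) show False by simp
    qed
    then have "chain_box j i E V y (V l) = {}" by blast
    then have "?L = 0"
      using VW[OF kl(2)] \<open>finite W\<close> by (intro prod_zero) (auto intro!: bexI[of _ "V l"])
    moreover have "0 \<le> ?c * ?M ^ n * ?T"
      using q r T by (intro mult_nonneg_nonneg zero_le_power) auto
    ultimately show ?thesis by simp
  qed
qed

text \<open>The \<open>m ^ (i - j)\<close> choices of \<open>y\<close> cancel the denominators
  \<open>m\<close>, the choices of \<open>V\<close> are absorbed by
  \<open>mult_power_one_minus_le\<close>, and each of the \<open>Suc (i - j)\<close> edges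
  contributes a factor \<open>card \<E>\<close>.\<close>

lemma sum_chain_boxes_le:
  fixes \<E> :: "'a set set"
  assumes ji: "j \<le> i" "i < r" and "finite W" and "finite \<E>"
    and \<E>: "\<And>e. e \<in> \<E> \<Longrightarrow> e \<subseteq> W \<and> card e = n"
  shows "(\<Sum>E\<in>{j..i} \<rightarrow>\<^sub>E \<E>. \<Sum>V\<in>(\<Pi>\<^sub>E l\<in>{j..<i}. E l \<inter> E (Suc l)). \<Sum>y\<in>{j..<i} \<rightarrow>\<^sub>E {1..m}.
      \<Prod>u\<in>W. sum weight (chain_box j i E V y u)) \<le>
    (real (card \<E>) * (1 - 1 / real r) ^ n) ^ Suc (i - j) *
    exp (- (real n * real r / (real r - 1)) * ((short i + prev_short j) / 2)) *
    (q * exp (19 / 10 + real n * real r / (real r - 1) * (q / real m)) * (400 * (real r)\<^sup>2 / 361)) ^ (i - j)"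
proof -
  let ?d = "i - j" and ?g = "(19 / (20 * real r))\<^sup>2"
  let ?t = "\<lambda>E l. card (E l \<inter> E (Suc l))"
  define M where "M = ((1 - 1 / real r) ^ Suc ?d * exp (- (real r / (real r - 1)) *
        ((short i + prev_short j) / 2 - real ?d * (q / real m)))) ^ n"
  have M0: "0 \<le> M"
    unfolding M_def using r by simp
  have g: "0 < ?g" "?g \<le> 1"
    using r by (auto simp: power_le_one)
  have inner: "(\<Sum>V\<in>(\<Pi>\<^sub>E l\<in>{j..<i}. E l \<inter> E (Suc l)). \<Sum>y\<in>{j..<i} \<rightarrow>\<^sub>E {1..m}.
      \<Prod>u\<in>W. sum weight (chain_box j i E V y u)) \<le>
    (q * exp (29 / 10)) ^ ?d * M * (exp (- 1) / ?g) ^ ?d" if E: "E \<in> {j..i} \<rightarrow>\<^sub>E \<E>" for E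
  proof -
    have El: "E l \<subseteq> W \<and> card (E l) = n" if "l \<in> {j..i}" for l
      using \<E> E that by (auto simp: PiE_def Pi_def)
    have "(\<Sum>V\<in>(\<Pi>\<^sub>E l\<in>{j..<i}. E l \<inter> E (Suc l)). \<Sum>y\<in>{j..<i} \<rightarrow>\<^sub>E {1..m}.
        \<Prod>u\<in>W. sum weight (chain_box j i E V y u)) \<le>
      (\<Sum>V\<in>(\<Pi>\<^sub>E l\<in>{j..<i}. E l \<inter> E (Suc l)). \<Sum>y\<in>{j..<i} \<rightarrow>\<^sub>E {1..m}.
        (q / real m * exp (29 / 10)) ^ ?d * M * (\<Prod>l\<in>{j..<i}. (1 - ?g) ^ ?t E l))"
      unfolding M_def using El assms(3)
      by (intro sum_mono prod_chain_box_le ji) (auto simp: PiE_def Pi_def)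
    also have "\<dots> = real (\<Prod>l\<in>{j..<i}. ?t E l) * (real m ^ ?d *
        ((q / real m * exp (29 / 10)) ^ ?d * M * (\<Prod>l\<in>{j..<i}. (1 - ?g) ^ ?t E l)))"
      by (simp add: card_PiE)
    also have "\<dots> = (q * exp (29 / 10)) ^ ?d * M * (\<Prod>l\<in>{j..<i}. real (?t E l) * (1 - ?g) ^ ?t E l)"
      using m by (simp add: prod.distrib power_mult_distrib power_divide)
    also have "\<dots> \<le> (q * exp (29 / 10)) ^ ?d * M * (\<Prod>l\<in>{j..<i}. exp (- 1) / ?g)"
      using g q M0 by (intro mult_left_mono prod_mono conjI mult_power_one_minus_le) auto
    finally show ?thesis by simp
  qed
  have "(\<Sum>E\<in>{j..i} \<rightarrow>\<^sub>E \<E>. \<Sum>V\<in>(\<Pi>\<^sub>E l\<in>{j..<i}. E l \<inter> E (Suc l)). \<Sum>y\<in>{j..<i} \<rightarrow>\<^sub>E {1..m}.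
      \<Prod>u\<in>W. sum weight (chain_box j i E V y u)) \<le>
    (\<Sum>E\<in>{j..i} \<rightarrow>\<^sub>E \<E>. (q * exp (29 / 10)) ^ ?d * M * (exp (- 1) / ?g) ^ ?d)"
    by (intro sum_mono inner)
  also have "\<dots> = real (card \<E>) ^ Suc ?d * ((q * exp (29 / 10)) ^ ?d * M * (exp (- 1) / ?g) ^ ?d)"
    using ji by (simp add: card_PiE Suc_diff_le)
  also have "M = ((1 - 1 / real r) ^ n) ^ Suc ?d *
      exp (- (real n * real r / (real r - 1)) * ((short i + prev_short j) / 2)) *
      exp (real n * real r / (real r - 1) * (q / real m)) ^ ?d"
  proof -
    have "exp (- (real r / (real r - 1)) * ((short i + prev_short j) / 2 - real ?d * (q / real m))) ^ n =
      exp (- (real n * real r / (real r - 1)) * ((short i + prev_short j) / 2)) *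
      exp (real n * real r / (real r - 1) * (q / real m)) ^ ?d"
    proof -
      have "real n * (- c * (h - real ?d * k)) = - (real n * c) * h + real ?d * (real n * c * k)" for c h k
        by (simp add: algebra_simps)
      then show ?thesis
        unfolding exp_of_nat_mult[symmetric] exp_add[symmetric] times_divide_eq_right[symmetric]
        by (rule arg_cong)
    qed
    moreover have "((1 - 1 / real r) ^ Suc ?d) ^ n = ((1 - 1 / real r) ^ n) ^ Suc ?d"
      by (metis power_mult mult.commute)
    ultimately show ?thesis
      unfolding M_def power_mult_distrib by (simp only: mult.assoc)
  qed
  also have "exp (- 1) / ?g = exp (- 1) * (400 * (real r)\<^sup>2 / 361)"
    by (simp add: power2_eq_square)
  also have "real (card \<E>) ^ Suc ?d * ((q * exp (29 / 10)) ^ ?d * (((1 - 1 / real r) ^ n) ^ Suc ?d *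
      exp (- (real n * real r / (real r - 1)) * ((short i + prev_short j) / 2)) *
      exp (real n * real r / (real r - 1) * (q / real m)) ^ ?d) * (exp (- 1) * (400 * (real r)\<^sup>2 / 361)) ^ ?d) =
    (real (card \<E>) * (1 - 1 / real r) ^ n) ^ Suc (i - j) *
    exp (- (real n * real r / (real r - 1)) * ((short i + prev_short j) / 2)) *
    (q * (exp (29 / 10) * exp (- 1) * exp (real n * real r / (real r - 1) * (q / real m))) *
      (400 * (real r)\<^sup>2 / 361)) ^ (i - j)"
    by (simp only: power_mult_distrib mult_ac)
  also have "exp (29 / 10) * exp (- 1) * exp (real n * real r / (real r - 1) * (q / real m)) =
      exp (19 / 10 + real n * real r / (real r - 1) * (q / real m))"
    unfolding exp_add[symmetric] by simp
  finally show ?thesis .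
qed

text \<open>Every placement gives a colouring that fails on some edge, hence a chain. Restricting
  its functions to their index ranges turns it into one of finitely many indices.\<close>

lemma interval_coloring_cover:
  fixes \<E> :: "'a set set"
  assumes "finite W" and sub: "\<E> \<subseteq> Pow W"
    and non: "\<nexists>c. panchromatic r W \<E> c" and X: "X \<in> W \<rightarrow> \<Omega>"
  shows "\<exists>i<r. \<exists>j\<le>i. \<exists>E\<in>{j..i} \<rightarrow>\<^sub>E \<E>. \<exists>V\<in>(\<Pi>\<^sub>E l\<in>{j..<i}. E l \<inter> E (Suc l)).
    \<exists>y\<in>{j..<i} \<rightarrow>\<^sub>E {1..m}. \<forall>u\<in>W. X u \<in> chain_box j i E V y u"
proof -
  have \<E>: "\<And>e. e \<in> \<E> \<Longrightarrow> e \<subseteq> W"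
    using sub by blast
  have Xr: "fst (X u) < r" "snd (X u) \<le> m" if "u \<in> W" for u
    using X[THEN Pi_mem, OF that] by (auto simp: \<Omega>_def)
  have "vertex_coloring r W (interval_coloring r \<E> X)"
    using Xr by (fastforce simp: vertex_coloring_def interval_coloring_def)
  with non obtain e i' where e: "e \<in> \<E>" "i' \<in> {1..r}" "\<And>u. u \<in> e \<Longrightarrow> interval_coloring r \<E> X u \<noteq> i'"
    unfolding panchromatic_def by metis
  then obtain i where i: "i' = Suc i" "i < r"
    by (cases i') auto
  have "\<exists>j\<le>i. \<exists>E V Y. Y i = 0 \<and> (\<forall>l<j. Y l = Suc m) \<and>
     (\<forall>l\<in>{j..i}. E l \<in> \<E> \<and> (\<forall>u\<in>E l. X u \<notin> forbidden Y l)) \<and>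
     (\<forall>l\<in>{j..<i}. V l \<in> E l \<inter> E (Suc l) \<and> X (V l) = (l, Y l) \<and> 0 < Y l)"
    using e i \<E> assms(1) by (intro missing_color_chain[where r = r]) (auto intro: finite_subset)
  then obtain j E V Y where j: "j \<le> i" and Y: "Y i = 0" "\<forall>l<j. Y l = Suc m"
    and E: "\<And>l. l \<in> {j..i} \<Longrightarrow> E l \<in> \<E> \<and> (\<forall>u\<in>E l. X u \<notin> forbidden Y l)"
    and V: "\<And>l. l \<in> {j..<i} \<Longrightarrow> V l \<in> E l \<inter> E (Suc l) \<and> X (V l) = (l, Y l) \<and> 0 < Y l"
    by blast
  let ?E = "restrict E {j..i}" and ?V = "restrict V {j..<i}" and ?y = "restrict Y {j..<i}"
  have "thresholds j i ?y l = Y l" if "l \<le> i" for l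
    using that Y by (auto simp: thresholds_def)
  then have forb: "forbidden (thresholds j i ?y) l = forbidden Y l" if "l \<le> i" for l
    using that by (auto simp: forbidden_def)
  have "Y l \<le> m" if "l \<in> {j..<i}" for l
  proof -
    have "V l \<in> W"
      using V[OF that] E[of l] \<E> that by fastforce
    then show ?thesis
      using Xr(2)[of "V l"] V[OF that] by simp
  qed
  then have "?y \<in> {j..<i} \<rightarrow>\<^sub>E {1..m}"
    using V by (auto simp: Suc_le_eq)
  moreover have "?V \<in> (\<Pi>\<^sub>E l\<in>{j..<i}. ?E l \<inter> ?E (Suc l))"
    using V by auto
  moreover have "?E \<in> {j..i} \<rightarrow>\<^sub>E \<E>"
    using E by auto
  moreover have "\<forall>u\<in>W. X u \<in> chain_box j i ?E ?V ?y u"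
    using X E V forb by (auto simp: chain_box_def)
  ultimately show ?thesis
    using i(2) j by blast
qed

end

section \<open>Existence of a non-colourable hypergraph, and the final count\<close>

text \<open>Take all \<open>n\<close>-subsets of \<open>2 * n\<close> points: fewer than
  \<open>n\<close> points may avoid colour 1 and fewer than \<open>n\<close> colour 2, yet every
  point avoids one of them. This ensures that the minimum is attained.\<close>

lemma exists_nonpanchromatic:
  fixes n r :: nat
  assumes "2 \<le> r"
  shows "\<exists>(V :: nat set) E. hypergraph V E \<and> uniform n E \<and> (\<nexists>c. panchromatic r V E c)"
proof (intro exI conjI)
  let ?V = "{..<2 * n}" and ?E = "{e. e \<subseteq> {..<2 * n} \<and> card e = n}"
  show "hypergraph ?V ?E" "uniform n ?E"
    by (auto simp: hypergraph_def uniform_def)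
  show "\<nexists>c. panchromatic r ?V ?E c"
  proof
    assume "\<exists>c. panchromatic r ?V ?E c"
    then obtain c where c: "panchromatic r ?V ?E c" ..
    have small: "card {v\<in>?V. c v \<noteq> i} < n" if "i \<in> {1, 2}" for i
    proof (rule ccontr)
      assume "\<not> card {v\<in>?V. c v \<noteq> i} < n"
      then have "n \<le> card {v\<in>?V. c v \<noteq> i}" by simp
      then obtain e where e: "e \<subseteq> {v\<in>?V. c v \<noteq> i}" "card e = n"
        by (rule obtain_subset_with_card_n)
      then have "e \<in> ?E" by auto
      moreover have "i \<in> {1..r}"
        using that assms by auto
      ultimately have "\<exists>v\<in>e. c v = i"
        using c unfolding panchromatic_def by (elim conjE) (drule (1) bspec)+
      with e(1) show False by auto
    qed
    have "2 * n = card ({v\<in>?V. c v \<noteq> 1} \<union> {v\<in>?V. c v \<noteq> 2})"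
      by (subst card_lessThan[symmetric]) (rule arg_cong[where f = card], auto)
    also have "\<dots> \<le> card {v\<in>?V. c v \<noteq> 1} + card {v\<in>?V. c v \<noteq> 2}"
      by (rule card_Un_le)
    also have "\<dots> < 2 * n"
      using small[of 1] small[of 2] by simp
    finally show False by simp
  qed
qed

lemma card_edges_nonpanchromatic_ge:
  fixes W :: "'a set" and \<E> :: "'a set set"
  assumes n: "n \<ge> 3" and r: "r \<ge> 2"
    and nr: "real r \<le> root 3 (real n / (100 * ln (real n)))"
    and H: "hypergraph W \<E>" "uniform n \<E>" and non: "\<nexists>c. panchromatic r W \<E> c"
  shows "1 / (20 * (real r)\<^sup>2) * (real n / ln (real n)) powr ((real r - 1) / real r)
      * (real r / (real r - 1)) ^ n \<le> real (card \<E>)"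
proof (rule ccontr)
  define R where "R = real n / ln (real n)"
  define \<alpha> where "\<alpha> = (real r - 1) / real r"
  define P where "P = R powr \<alpha>"
  define T where "T = real (card \<E>) * (1 - 1 / real r) ^ n"
  \<comment> \<open>Chosen so that an excess of \<open>q / 2\<close> in the forbidden sets
    contributes exactly the factor \<open>1 / P\<close>.\<close>
  define q where "q = 2 * \<alpha>\<^sup>2 * ln R / real n"
  assume "\<not> ?thesis"
  then have few: "real (card \<E>) < 1 / (20 * (real r)\<^sup>2) * P * (real r / (real r - 1)) ^ n"
    by (simp add: P_def R_def \<alpha>_def)
  have r2: "real r \<ge> 2"
    using r by simp
  have \<alpha>: "0 < \<alpha>" "\<alpha> \<le> 1"
    using r2 by (auto simp: \<alpha>_def)
  have "exp 1 \<le> real n"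
    using exp_le n by linarith
  then have ln_n: "ln (real n) \<ge> 1"
    using n by (simp add: ln_ge_iff)
  have "real r ^ 3 \<le> root 3 (real n / (100 * ln (real n))) ^ 3"
    using nr by (intro power_mono) auto
  also have "\<dots> = R / 100"
    using ln_n by (simp add: R_def)
  finally have R_ge: "100 * real r ^ 3 \<le> R"
    by simp
  have "real r ^ 3 \<ge> 2 ^ 3"
    using r2 by (intro power_mono) auto
  then have R1: "1 < R"
    using R_ge by simp
  then have lnR: "0 < ln R" by simp
  have "R \<le> real n"
    using ln_n mult_left_mono[OF ln_n, of "real n"] by (simp add: R_def field_simps)
  then have "ln R \<le> ln (real n)"
    using R1 by simp
  have q0: "0 \<le> q"
    using lnR by (simp add: q_def)
  have "q \<le> 2 * 1 * ln (real n) / real n"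
    unfolding q_def using \<alpha> lnR \<open>ln R \<le> ln (real n)\<close>
    by (intro divide_right_mono mult_mono) (auto simp: power_le_one)
  then have qR: "q \<le> 2 / R"
    by (simp add: R_def)
  have q_small: "200 * real r * q \<le> 1"
  proof -
    have "200 * real r * q \<le> 200 * real r * (2 / R)"
      using qR by (intro mult_left_mono) auto
    also have "\<dots> = 400 * real r / R"
      by simp
    also have "\<dots> \<le> 1"
    proof -
      have "4 * real r \<le> real r ^ 2 * real r"
        using power_mono[of 2 "real r" 2] r2 by (intro mult_right_mono) auto
      then have "400 * real r \<le> R"
        using R_ge by (simp add: power3_eq_cube power2_eq_square)
      then show ?thesis
        using R1 by simp
    qed
    finally show ?thesis .
  qed
  \<comment> \<open>With \<open>m = n\<close> positions, the discretisation error per link is the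
    exponent \<open>r / (r - 1) * q\<close>, at most 1/10.\<close>
  interpret interval_weights r n q
    using r n q0 q_small by unfold_locales auto
  have fin: "finite W" "finite \<E>" and edge: "\<And>e. e \<in> \<E> \<Longrightarrow> e \<subseteq> W \<and> card e = n"
    using H by (auto simp: hypergraph_def uniform_def intro: finite_subset)
  then have sub: "\<E> \<subseteq> Pow W"
    by blast
  define I where "I = (SIGMA i:{..<r}. SIGMA j:{..i}. SIGMA E:{j..i} \<rightarrow>\<^sub>E \<E>.
    SIGMA V:(\<Pi>\<^sub>E l\<in>{j..<i}. E l \<inter> E (Suc l)). {j..<i} \<rightarrow>\<^sub>E {1..n})"
  define F where "F i j E V y = (\<Prod>u\<in>W. sum weight (chain_box j i E V y u))"
    for i j and E :: "nat \<Rightarrow> 'a set" and V y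
  have finV: "finite (\<Pi>\<^sub>E l\<in>{j..<i}. E l \<inter> E (Suc l))" if "E \<in> {j..i} \<rightarrow>\<^sub>E \<E>" for i j E
  proof (intro finite_PiE finite_Int disjI1)
    fix l assume "l \<in> {j..<i}"
    then have "E l \<in> \<E>"
      using that by (auto simp: PiE_def Pi_def)
    then show "finite (E l)"
      using edge fin(1) by (blast intro: finite_subset)
  qed simp
  have finE: "finite ({j..i} \<rightarrow>\<^sub>E \<E>)" for i j :: nat
    using fin by (intro finite_PiE) auto
  have finy: "finite ({j..<i} \<rightarrow>\<^sub>E {1..n})" for i j :: nat
    by (intro finite_PiE) auto
  have finI: "finite I"
    unfolding I_def using finV finE finy by (intro finite_SigmaI) auto
  have "1 \<le> (\<Sum>z\<in>I. \<Prod>u\<in>W. sum weight (case z of (i, j, E, V, y) \<Rightarrow> chain_box j i E V y u))"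
  proof (rule box_cover_bound[OF fin(1) finite_\<Omega> finI weight_nonneg sum_weight])
    fix X assume "X \<in> W \<rightarrow>\<^sub>E \<Omega>"
    then have "X \<in> W \<rightarrow> \<Omega>" by auto
    from interval_coloring_cover[OF fin(1) sub non this]
    obtain i j E V y where *: "i < r" "j \<le> i" "E \<in> {j..i} \<rightarrow>\<^sub>E \<E>"
      "V \<in> (\<Pi>\<^sub>E l\<in>{j..<i}. E l \<inter> E (Suc l))" "y \<in> {j..<i} \<rightarrow>\<^sub>E {1..n}" "\<forall>u\<in>W. X u \<in> chain_box j i E V y u"
      by (elim exE bexE conjE) (rule that)
    then have "(i, j, E, V, y) \<in> I"
      by (simp add: I_def)
    with *(6) show "\<exists>z\<in>I. \<forall>u\<in>W. X u \<in> (case z of (i, j, E, V, y) \<Rightarrow> chain_box j i E V y u)"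
      by (intro bexI[of _ "(i, j, E, V, y)"]) auto
  qed (auto simp: chain_box_def split: prod.splits)
  also have "\<dots> = (\<Sum>(i, j, E, V, y)\<in>I. F i j E V y)"
    by (intro sum.cong) (auto simp: F_def)
  also have "\<dots> = (\<Sum>i<r. \<Sum>j\<le>i. \<Sum>E\<in>{j..i} \<rightarrow>\<^sub>E \<E>. \<Sum>V\<in>(\<Pi>\<^sub>E l\<in>{j..<i}. E l \<inter> E (Suc l)).
      \<Sum>y\<in>{j..<i} \<rightarrow>\<^sub>E {1..n}. F i j E V y)"
    unfolding I_def using finV finE finy by (simp add: sum.Sigma finite_SigmaI)
  also have "\<dots> \<le> (\<Sum>i<r. \<Sum>j\<le>i. 1 / (20 * (real r)\<^sup>2))"
  proof (intro sum_mono)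
    fix i j assume "i \<in> {..<r}" "j \<in> {..i}"
    then have ji: "j \<le> i" "i < r" by auto
    let ?d = "i - j" and ?h = "(short i + prev_short j) / 2"
    have P1: "1 \<le> P" "P \<le> R"
      using R1 \<alpha> powr_mono[of \<alpha> 1 R] by (auto simp: P_def ge_one_powr_ge_zero)
    have T: "0 \<le> T" "T \<le> P / (20 * (real r)\<^sup>2)"
    proof -
      show "0 \<le> T"
        using r2 by (simp add: T_def)
      have "T \<le> (1 / (20 * (real r)\<^sup>2) * P * (real r / (real r - 1)) ^ n) * (1 - 1 / real r) ^ n"
        unfolding T_def using few r2 by (intro mult_right_mono) auto
      also have "\<dots> = P / (20 * (real r)\<^sup>2) * (real r / (real r - 1) * (1 - 1 / real r)) ^ n"
        unfolding power_mult_distrib by simp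
      also have "real r / (real r - 1) * (1 - 1 / real r) = 1"
        using r2 by (simp add: field_simps)
      finally show "T \<le> P / (20 * (real r)\<^sup>2)"
        by simp
    qed
    define Z where "Z = q * exp (19 / 10 + real n * real r / (real r - 1) * (q / real n)) * (400 * (real r)\<^sup>2 / 361)"
    have Z: "0 \<le> Z" "Z \<le> 20 * (real r)\<^sup>2 / R"
    proof -
      show "0 \<le> Z"
        using q0 by (simp add: Z_def)
      have "real n * real r / (real r - 1) * (q / real n) = real r / (real r - 1) * q"
        using n by simp
      also have "\<dots> \<le> 2 * q"
        using r2 q0 by (intro mult_right_mono) (auto simp: field_simps)
      also have "\<dots> \<le> 1 / 10"
        using q_small q0 mult_right_mono[OF r2 q0] by simp
      finally have "exp (19 / 10 + real n * real r / (real r - 1) * (q / real n)) \<le> exp (1 + 1 :: real)"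
        by simp
      also have "\<dots> \<le> 3 * 3"
        unfolding exp_add using exp_le by (intro mult_mono) auto
      \<comment> \<open>The source of the constant 20: \<open>2 * 9 * 400 / 361\<close> is just
        below it.\<close>
      finally have "Z \<le> 2 / R * 9 * (400 * (real r)\<^sup>2 / 361)"
        unfolding Z_def using qR q0 R1 by (intro mult_mono mult_right_mono) auto
      also have "\<dots> \<le> 20 * (real r)\<^sup>2 / R"
        using R1 by (simp add: field_simps)
      finally show "Z \<le> \<dots>" .
    qed
    have "(\<Sum>E\<in>{j..i} \<rightarrow>\<^sub>E \<E>. \<Sum>V\<in>(\<Pi>\<^sub>E l\<in>{j..<i}. E l \<inter> E (Suc l)).
        \<Sum>y\<in>{j..<i} \<rightarrow>\<^sub>E {1..n}. F i j E V y) \<le>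
        T ^ Suc ?d * exp (- (real n * real r / (real r - 1)) * ?h) * Z ^ ?d"
      unfolding F_def T_def Z_def using sum_chain_boxes_le[OF ji fin edge] .
    also have "\<dots> \<le> (P / (20 * (real r)\<^sup>2)) ^ Suc ?d * exp (- (real n * real r / (real r - 1)) * ?h) *
        (20 * (real r)\<^sup>2 / R) ^ ?d"
      using T Z P1 by (intro mult_mono power_mono) auto
    \<comment> \<open>Each link brings one further edge, so its factors
      \<open>20 * r\<^sup>2\<close> cancel; only the one from the first edge survives.\<close>
    also have "\<dots> = 1 / (20 * (real r)\<^sup>2) * (P * (P / R) ^ ?d * exp (- (real n * real r / (real r - 1)) * ?h))"
      using r2 R1 by (simp add: power_divide power_mult_distrib field_simps)
    also have "\<dots> \<le> 1 / (20 * (real r)\<^sup>2) * 1"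
    proof (rule mult_left_mono)
      show "P * (P / R) ^ ?d * exp (- (real n * real r / (real r - 1)) * ?h) \<le> 1"
      \<comment> \<open>The full chain has no excess, but \<open>P ^ r = R ^ (r - 1)\<close>
        balances it. Any other chain has excess at least \<open>q / 2\<close>, and the resulting
        factor \<open>1 / P\<close> cancels \<open>P\<close>.\<close>
      proof (cases "Suc i = r \<and> j = 0")
        case True
        then have "P * P ^ ?d = R ^ ?d"
        proof -
          have "P * P ^ ?d = P ^ r"
            using True by (simp flip: power_Suc)
          also have "\<dots> = R powr (\<alpha> * real r)"
            using R1 by (simp add: P_def powr_powr flip: powr_realpow)
          also have "\<alpha> * real r = real ?d"
            using True r2 by (auto simp: \<alpha>_def)
          also have "R powr real ?d = R ^ ?d"
            using R1 by (simp add: powr_realpow)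
          finally show ?thesis .
        qed
        moreover have "?h = 0"
          using True by (auto simp: short_def prev_short_def)
        ultimately show ?thesis
          using R1 by (simp add: power_divide)
      next
        case False
        then have "short i = q \<or> prev_short j = q"
          using ji by (auto simp: short_def prev_short_def split: nat.split)
        then have h: "q / 2 \<le> ?h"
          using short_bounds[of i] short_bounds[of j] by auto
        have "\<alpha> * ln R = real n * real r / (real r - 1) * (q / 2)"
          using r2 n by (simp add: q_def \<alpha>_def power2_eq_square)
        also have "\<dots> \<le> real n * real r / (real r - 1) * ?h"
          using h r2 by (intro mult_left_mono) auto
        finally have "exp (- (real n * real r / (real r - 1)) * ?h) \<le> exp (- (\<alpha> * ln R))"
          by simp
        also have "\<dots> = 1 / P"
          using R1 by (simp add: P_def powr_def exp_minus field_simps)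
        finally have "P * (P / R) ^ ?d * exp (- (real n * real r / (real r - 1)) * ?h) \<le> P * 1 * (1 / P)"
          using P1 R1 by (intro mult_mono power_le_one) auto
        then show ?thesis
          using P1 by simp
      qed
    qed simp
    finally show "(\<Sum>E\<in>{j..i} \<rightarrow>\<^sub>E \<E>. \<Sum>V\<in>(\<Pi>\<^sub>E l\<in>{j..<i}. E l \<inter> E (Suc l)).
        \<Sum>y\<in>{j..<i} \<rightarrow>\<^sub>E {1..n}. F i j E V y) \<le> 1 / (20 * (real r)\<^sup>2)"
      by simp
  qed
  \<comment> \<open>There are at most \<open>r\<^sup>2\<close> pairs of chain ends, so the total
    probability is at most 1/20, contradicting the union bound.\<close>
  also have "\<dots> \<le> (\<Sum>i<r. real r * (1 / (20 * (real r)\<^sup>2)))"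
  proof (intro sum_mono)
    fix i assume "i \<in> {..<r}"
    then have "real (Suc i) \<le> real r" by auto
    then have "real (Suc i) * (1 / (20 * (real r)\<^sup>2)) \<le> real r * (1 / (20 * (real r)\<^sup>2))"
      by (rule mult_right_mono) simp
    then show "(\<Sum>j\<le>i. 1 / (20 * (real r)\<^sup>2)) \<le> real r * (1 / (20 * (real r)\<^sup>2))"
      by simp
  qed
  also have "\<dots> = 1 / 20"
    using r2 by (simp add: power2_eq_square)
  finally show False by simp
qed

theorem theorem1:
  fixes n r :: nat
  assumes "n \<ge> 3" and "r \<ge> 2"
    and "real r \<le> root 3 (real n / (100 * ln (real n)))"
  shows "real (min_edges n r) \<ge>
    1 / (20 * (real r)\<^sup>2) * (real n / ln (real n)) powr ((real r - 1) / real r)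
      * (real r / (real r - 1)) ^ n"
proof -
  have "\<exists>m (V :: nat set) E. hypergraph V E \<and> uniform n E \<and> (\<nexists>c. panchromatic r V E c) \<and> card E = m"
    using exists_nonpanchromatic[OF assms(2), of n] by blast
  then have "\<exists>(V :: nat set) E. hypergraph V E \<and> uniform n E \<and> (\<nexists>c. panchromatic r V E c) \<and>
      card E = min_edges n r"
    unfolding min_edges_def by (rule LeastI_ex)
  then show ?thesis
    using card_edges_nonpanchromatic_ge[OF assms] by metis
qed

end
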